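(* Consider the single-frequency RoPE phase flow on the circle with $n\ge2$ tokens at positions $p_j=j$, $j=0,\dots,n-1$, finite $\beta\ge0$, and frequency $\omega=2\pi m/n$ with $m\in\mathbb{Z}$. Let $\bar m\in\{0,\dots,n-1\}$ be $m$ modulo $n$ and assume $\bar m\ne0$. At the twisted equilibrium $\theta_j=c-\omega j$ ($c\in\mathbb{R}$), the Jacobian of the phase vector field is $$J=\frac1nC,\qquad C_{ij}=\cos\left(\frac{2\pi m(i-j)}n\right).$$ If $2\bar m\not\equiv0\pmod n$, then $J$ has eigenvalue $\tfrac12$ with multiplicity $2$ and eigenvalue $0$ with multiplicity $n-2$. If $n$ is even and $\bar m=n/2$, then $J$ has eigenvalue $1$ with multiplicity $1$ and eigenvalue $0$ with multiplicity $n-1$. Hence these equilibria have growing linear modes (eigenvalues with positive real part) and center modes (eigenvalues with zero real part), but no linearly stable modes (eigenvalues with negative real part); they are therefore non-hyperbolic and linearly unstable, not saddles in the usual hyperbolic sense.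
   Context: Phase flow: for phases $\theta=(\theta_0,\dots,\theta_{n-1})$, let $W_{ij}=\exp\bigl(\beta\cos(\theta_i-\theta_j+\omega(p_i-p_j))\bigr)$, $A_{ij}=W_{ij}/\sum_kW_{ik}$, and $\dot\theta_i=\sum_jA_{ij}(\theta)\sin(\theta_j-\theta_i)$. When $n\omega\in2\pi\mathbb{Z}$, the twisted configuration $\theta_j=c-\omega j$ is an equilibrium of this flow. *)

theory Defs
  imports
    "HOL-Analysis.Analysis"
    "HOL-Computational_Algebra.Polynomial"
    "HOL-Number_Theory.Cong"
begin

section \<open>The RoPE phase flow\<close>

text \<open>
  The finite type \<open>'n\<close> indexes the tokens, \<open>p i\<close> is the position of token \<open>i\<close>, and a point of the
  torus is represented by a lift in \<open>real ^ 'n\<close>: the vector field is \<open>2 * pi\<close>-periodic in every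
  coordinate, so its zeros and its Jacobian do not depend on the lift.
\<close>

definition attn_weight :: "real \<Rightarrow> real \<Rightarrow> ('n \<Rightarrow> real) \<Rightarrow> real ^ 'n \<Rightarrow> 'n \<Rightarrow> 'n \<Rightarrow> real" where
  "attn_weight \<beta> \<omega> p \<theta> i j = exp (\<beta> * cos (\<theta> $ i - \<theta> $ j + \<omega> * (p i - p j)))"

definition attn :: "real \<Rightarrow> real \<Rightarrow> ('n::finite \<Rightarrow> real) \<Rightarrow> real ^ 'n \<Rightarrow> 'n \<Rightarrow> 'n \<Rightarrow> real" where
  "attn \<beta> \<omega> p \<theta> i j = attn_weight \<beta> \<omega> p \<theta> i j / (\<Sum>k\<in>UNIV. attn_weight \<beta> \<omega> p \<theta> i k)"

definition phase_field :: "real \<Rightarrow> real \<Rightarrow> ('n::finite \<Rightarrow> real) \<Rightarrow> real ^ 'n \<Rightarrow> real ^ 'n" where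
  "phase_field \<beta> \<omega> p \<theta> = (\<chi> i. \<Sum>j\<in>UNIV. attn \<beta> \<omega> p \<theta> i j * sin (\<theta> $ j - \<theta> $ i))"

definition twisted :: "real \<Rightarrow> real \<Rightarrow> ('n \<Rightarrow> real) \<Rightarrow> real ^ 'n" where
  "twisted c \<omega> p = (\<chi> j. c - \<omega> * p j)"


section \<open>Eigenvalues of square matrices and their multiplicities\<close>

definition eigenvalue :: "'a::field ^ 'n ^ 'n \<Rightarrow> 'a \<Rightarrow> bool" where
  "eigenvalue A \<mu> \<longleftrightarrow> (\<exists>v. v \<noteq> 0 \<and> A *v v = \<mu> *s v)"

definition char_poly :: "'a::field ^ 'n ^ 'n \<Rightarrow> 'a poly" where
  "char_poly A = det (mat [:0, 1:] - (\<chi> i j. [:A $ i $ j:]))"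

definition algebraic_multiplicity :: "'a::field ^ 'n ^ 'n \<Rightarrow> 'a \<Rightarrow> nat" where
  "algebraic_multiplicity A \<mu> = order \<mu> (char_poly A)"

definition geometric_multiplicity :: "'a::field ^ 'n ^ 'n \<Rightarrow> 'a \<Rightarrow> nat" where
  "geometric_multiplicity A \<mu> = vec.dim {v. A *v v = \<mu> *s v}"

text \<open>All matrices here turn out to be symmetric, so both notions of multiplicity are required
  to agree with the claimed value.\<close>

definition has_eigenvalue_with_multiplicity :: "'a::field ^ 'n ^ 'n \<Rightarrow> 'a \<Rightarrow> nat \<Rightarrow> bool" where
  "has_eigenvalue_with_multiplicity A \<mu> k \<longleftrightarrow>
     eigenvalue A \<mu> \<and> algebraic_multiplicity A \<mu> = k \<and> geometric_multiplicity A \<mu> = k"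

definition complexify :: "real ^ 'n ^ 'm \<Rightarrow> complex ^ 'n ^ 'm" where
  "complexify A = (\<chi> i j. complex_of_real (A $ i $ j))"


section \<open>Linearization of a vector field at an equilibrium\<close>

definition equilibrium :: "(real ^ 'n \<Rightarrow> real ^ 'n) \<Rightarrow> real ^ 'n \<Rightarrow> bool" where
  "equilibrium F x \<longleftrightarrow> F x = 0"

definition linear_mode :: "(real ^ 'n \<Rightarrow> real ^ 'n) \<Rightarrow> real ^ 'n \<Rightarrow> complex \<Rightarrow> bool" where
  "linear_mode F x \<mu> \<longleftrightarrow> eigenvalue (complexify (jacobian F (at x))) \<mu>"

definition has_growing_mode :: "(real ^ 'n \<Rightarrow> real ^ 'n) \<Rightarrow> real ^ 'n \<Rightarrow> bool" where
  "has_growing_mode F x \<longleftrightarrow> (\<exists>\<mu>. linear_mode F x \<mu> \<and> Re \<mu> > 0)"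

definition has_center_mode :: "(real ^ 'n \<Rightarrow> real ^ 'n) \<Rightarrow> real ^ 'n \<Rightarrow> bool" where
  "has_center_mode F x \<longleftrightarrow> (\<exists>\<mu>. linear_mode F x \<mu> \<and> Re \<mu> = 0)"

definition has_stable_mode :: "(real ^ 'n \<Rightarrow> real ^ 'n) \<Rightarrow> real ^ 'n \<Rightarrow> bool" where
  "has_stable_mode F x \<longleftrightarrow> (\<exists>\<mu>. linear_mode F x \<mu> \<and> Re \<mu> < 0)"

definition hyperbolic :: "(real ^ 'n \<Rightarrow> real ^ 'n) \<Rightarrow> real ^ 'n \<Rightarrow> bool" where
  "hyperbolic F x \<longleftrightarrow> (\<forall>\<mu>. linear_mode F x \<mu> \<longrightarrow> Re \<mu> \<noteq> 0)"

definition linearly_unstable :: "(real ^ 'n \<Rightarrow> real ^ 'n) \<Rightarrow> real ^ 'n \<Rightarrow> bool" where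
  "linearly_unstable F x \<longleftrightarrow> (\<exists>\<mu>. linear_mode F x \<mu> \<and> Re \<mu> > 0)"

definition hyperbolic_saddle :: "(real ^ 'n \<Rightarrow> real ^ 'n) \<Rightarrow> real ^ 'n \<Rightarrow> bool" where
  "hyperbolic_saddle F x \<longleftrightarrow> hyperbolic F x \<and> has_growing_mode F x \<and> has_stable_mode F x"

end

theory Submission
  imports Defs "HOL-Library.Real_Mod"
begin

text \<open>
  At a twisted configuration every angle inside the attention exponent vanishes. The attention is
  therefore uniform there, and since the cosine is stationary at \<open>0\<close>, it is also constant to
  first order (\<open>attn_has_derivative_zero_twisted\<close>). To first order the flow is thus the averaged
  coupling \<open>h i \<mapsto> (\<Sum>j. cos (\<omega> * (p i - p j)) * (h j - h i)) / n\<close>, independently of \<open>\<beta>\<close>. When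
  \<open>\<omega> = 2 * pi * m / n\<close> with \<open>m\<close> not divisible by \<open>n\<close>, the numbers \<open>cis (\<omega> * (p i - p j))\<close>
  are the values of a nontrivial character of the cyclic group and sum to \<open>0\<close>. The imaginary part of this
  sum is the equilibrium condition; the real part kills the terms in \<open>h i\<close> and leaves the circulant
  matrix \<open>J = C / n\<close> (\<open>phase_field_linearization_balanced\<close>).

  A circulant matrix is diagonalized by the discrete Fourier transform, and the kernel
  \<open>cos (2 * pi * m * x / n)\<close> consists of the two frequencies \<open>m\<close> and \<open>-m\<close> with weight \<open>1/2\<close>
  each (\<open>cosine_kernel_diagonalized_by_dft\<close>). So the spectrum is \<open>0\<close> except at the Fourier modes
  \<open>m\<close> and \<open>-m\<close>: either these are two different modes, each with eigenvalue \<open>1/2\<close>, or they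
  coincide, which means \<open>2 * m \<equiv> 0\<close>, and the two halves add up to a single eigenvalue \<open>1\<close>.
  The constant mode is neither of the two, so \<open>0\<close> is always an eigenvalue and the equilibrium is
  never hyperbolic. For a diagonalized matrix both multiplicities are read off from the diagonal
  (\<open>multiplicity_of_diagonalized\<close>).
\<close>

section \<open>Eigenvalue multiplicities of a diagonalized matrix\<close>

definition diag_mat :: "('n::finite \<Rightarrow> 'a::zero) \<Rightarrow> 'a ^ 'n ^ 'n" where
  "diag_mat d = (\<chi> i j. if i = j then d i else 0)"

lemma matrix_mult_diag_mat_nth:
  fixes V :: "'a::semiring_1 ^ 'n ^ 'm"
  shows "(V ** diag_mat d) $ i $ j = V $ i $ j * d j"
  by (simp add: matrix_matrix_mult_def diag_mat_def if_distrib[of "\<lambda>x. _ * x"] cong: if_cong)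

lemma diag_mat_mult_vec_nth:
  fixes w :: "'a::semiring_1 ^ 'n"
  shows "(diag_mat d *v w) $ i = d i * w $ i"
  by (simp add: matrix_vector_mult_def diag_mat_def if_distrib[of "\<lambda>x. x * _"] cong: if_cong)

lemma char_poly_diag_mat: "char_poly (diag_mat d) = (\<Prod>i\<in>UNIV. [:- d i, 1:])"
proof -
  have "char_poly (diag_mat d) = (\<Prod>i\<in>UNIV. (mat [:0, 1:] - (\<chi> i j. [:diag_mat d $ i $ j:])) $ i $ i)"
    unfolding char_poly_def by (rule det_diagonal) (simp add: mat_def diag_mat_def)
  also have "\<dots> = (\<Prod>i\<in>UNIV. [:- d i, 1:])"
    by (simp add: mat_def diag_mat_def)
  finally show ?thesis .
qed

lemma order_prod_linear_factors:
  fixes d :: "'b \<Rightarrow> 'a::idom"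
  assumes "finite S"
  shows "order \<mu> (\<Prod>i\<in>S. [:- d i, 1:]) = card {i \<in> S. d i = \<mu>}"
  using assms
proof (induction S)
  case (insert x S)
  have "(\<Prod>i\<in>insert x S. [:- d i, 1:]) \<noteq> 0"
    using insert by (subst prod_zero_iff) auto
  then have "order \<mu> (\<Prod>i\<in>insert x S. [:- d i, 1:])
      = order \<mu> [:- d x, 1:] + card {i \<in> S. d i = \<mu>}"
    using insert by (simp add: order_mult del: mult_pCons_left mult_pCons_right)
  moreover have "order \<mu> [:- d x, 1:] = (if d x = \<mu> then 1 else 0)"
    using order_power_n_n[of \<mu> 1] by (simp add: order_0I)
  moreover have "{i \<in> insert x S. d i = \<mu>}
      = (if d x = \<mu> then insert x {i \<in> S. d i = \<mu>} else {i \<in> S. d i = \<mu>})"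
    by auto
  ultimately show ?case using insert by simp
qed simp

text \<open>
  The relation \<open>A ** V = V ** B\<close>, read for matrices of constant polynomials, says that
  \<open>V\<close> intertwines \<open>X - A\<close> and \<open>X - B\<close>. Taking determinants, \<open>det V\<close> cancels because it
  is a unit.
\<close>

lemma char_poly_similar:
  fixes A B V :: "'a::field ^ 'n ^ 'n"
  assumes AV: "A ** V = V ** B" and V: "invertible V"
  shows "char_poly A = char_poly B"
proof -
  define lift :: "'a ^ 'n ^ 'n \<Rightarrow> 'a poly ^ 'n ^ 'n" where "lift M = (\<chi> i j. [:M $ i $ j:])" for M
  have const_add: "[:a + b:] = [:a:] + [:b:]" for a b :: 'a by simp
  have const_sum: "[:\<Sum>k\<in>S. f k:] = (\<Sum>k\<in>S. [:f k:])" for f :: "'n \<Rightarrow> 'a" and S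
    by (induction S rule: infinite_finite_induct) (simp_all add: const_add del: add_pCons)
  have lift_mult: "lift (M ** N) = lift M ** lift N" for M N
    by (simp add: lift_def matrix_matrix_mult_def vec_eq_iff const_sum mult.commute)
  obtain W where "V ** W = mat 1"
    using V by (auto simp: invertible_def)
  then have "lift V ** lift W = lift (mat 1)"
    by (simp add: lift_mult[symmetric])
  also have "\<dots> = mat 1"
    by (simp add: lift_def mat_def vec_eq_iff)
  finally have "det (lift V) * det (lift W) = 1"
    by (metis det_I det_mul)
  then have nz: "det (lift V) \<noteq> 0" by auto
  have diff_mult: "(P - Q) ** R = P ** R - Q ** R" and mult_diff: "R ** (P - Q) = R ** P - R ** Q"
    for P Q R :: "'a poly ^ 'n ^ 'n"
    by (simp_all add: vec_eq_iff matrix_matrix_mult_def sum_subtractf left_diff_distrib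
        right_diff_distrib)
  have "(mat [:0, 1:] - lift A) ** lift V = mat [:0, 1:] ** lift V - lift V ** lift B"
    by (simp add: lift_mult[symmetric] AV[symmetric] diff_mult)
  also have "mat [:0, 1:] ** lift V = lift V ** mat [:0, 1:]"
    by (simp add: vec_eq_iff matrix_matrix_mult_def mat_def if_distrib[of "\<lambda>x. _ * x"]
        if_distrib[of "\<lambda>x. x * _"] mult.commute cong: if_cong)
  finally have "(mat [:0, 1:] - lift A) ** lift V = lift V ** (mat [:0, 1:] - lift B)"
    by (simp add: mult_diff)
  then have "char_poly A * det (lift V) = det (lift V) * char_poly B"
    by (metis char_poly_def det_mul lift_def)
  with nz show ?thesis by simp
qed

text \<open>
  \<open>V\<close> carries the eigenspaces of the diagonal matrix, which are coordinate subspaces, onto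
  those of \<open>A\<close>; the shape of the coordinate subspace is the one used in
  \<open>dim_substandard_cart\<close>.
\<close>

lemma eigenspace_of_diagonalized:
  fixes A V :: "'a::field ^ 'n ^ 'n"
  assumes AV: "A ** V = V ** diag_mat d" and V: "invertible V"
  shows "{v. A *v v = \<mu> *s v} = (*v) V ` {w. \<forall>i. i \<notin> {k. d k = \<mu>} \<longrightarrow> w $ i = 0}"
proof -
  obtain W where W: "V ** W = mat 1" "W ** V = mat 1"
    using V by (auto simp: invertible_def)
  have inj: "V *v x = V *v y \<longleftrightarrow> x = y" for x y
    by (metis W(2) matrix_vector_mul_assoc matrix_vector_mul_lid)
  have "A *v (V *v w) = \<mu> *s (V *v w) \<longleftrightarrow> (\<forall>i. i \<notin> {k. d k = \<mu>} \<longrightarrow> w $ i = 0)" for w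
  proof -
    have "A *v (V *v w) = V *v (diag_mat d *v w)"
      by (simp add: matrix_vector_mul_assoc AV)
    moreover have "\<mu> *s (V *v w) = V *v (\<mu> *s w)"
      by (simp add: vec.scale)
    ultimately have "A *v (V *v w) = \<mu> *s (V *v w) \<longleftrightarrow> diag_mat d *v w = \<mu> *s w"
      by (simp add: inj)
    then show ?thesis by (auto simp: vec_eq_iff diag_mat_mult_vec_nth)
  qed
  moreover have "\<exists>w. v = V *v w" for v
    by (metis W(1) matrix_vector_mul_assoc matrix_vector_mul_lid)
  ultimately show ?thesis by (auto simp: image_iff) metis
qed

lemma eigenvalue_of_diagonalized:
  fixes A V :: "'a::field ^ 'n ^ 'n"
  assumes "A ** V = V ** diag_mat d" and "invertible V"
  shows "eigenvalue A \<mu> \<longleftrightarrow> \<mu> \<in> range d"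
proof
  assume "eigenvalue A \<mu>"
  then obtain v where v: "v \<noteq> 0" "v \<in> {v. A *v v = \<mu> *s v}"
    by (auto simp: eigenvalue_def)
  then obtain w where "v = V *v w" "\<forall>i. i \<notin> {k. d k = \<mu>} \<longrightarrow> w $ i = 0"
    unfolding eigenspace_of_diagonalized[OF assms] by auto
  with v(1) show "\<mu> \<in> range d"
    by (metis (mono_tags, lifting) matrix_vector_mult_0_right mem_Collect_eq rangeI vec_eq_iff zero_index)
next
  assume "\<mu> \<in> range d"
  then obtain k where k: "d k = \<mu>" by auto
  have "V *v axis k 1 \<in> {v. A *v v = \<mu> *s v}"
    unfolding eigenspace_of_diagonalized[OF assms] using k by (auto simp: axis_def)
  moreover have "V *v axis k 1 \<noteq> 0"
    using assms(2) by (metis axis_eq_0_iff invertible_def matrix_vector_mul_assoc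
        matrix_vector_mul_lid matrix_vector_mult_0_right zero_neq_one)
  ultimately show "eigenvalue A \<mu>" by (auto simp: eigenvalue_def)
qed

lemma multiplicity_of_diagonalized:
  fixes A V :: "'a::field ^ 'n ^ 'n"
  assumes AV: "A ** V = V ** diag_mat d" and V: "invertible V" and \<mu>: "\<mu> \<in> range d"
  shows "has_eigenvalue_with_multiplicity A \<mu> (card {k. d k = \<mu>})"
proof -
  have "algebraic_multiplicity A \<mu> = card {k. d k = \<mu>}"
    unfolding algebraic_multiplicity_def
    by (simp add: char_poly_similar[OF AV V] char_poly_diag_mat order_prod_linear_factors)
  moreover have "inj ((*v) V)"
    using V by (metis inj_matrix_vector_mult)
  then have "geometric_multiplicity A \<mu> = card {k. d k = \<mu>}"
    unfolding geometric_multiplicity_def eigenspace_of_diagonalized[OF AV V]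
    by (subst vec.dim_image_eq)
      (auto intro: matrix_vector_mul_linear_gen inj_on_subset simp del: mem_Collect_eq
        simp: dim_substandard_cart)
  ultimately show ?thesis
    using eigenvalue_of_diagonalized[OF AV V] \<mu>
    by (simp add: has_eigenvalue_with_multiplicity_def)
qed

section \<open>The phase flow near a twisted configuration\<close>

lemma has_derivative_vec_lambda:
  fixes f :: "'a::real_normed_vector \<Rightarrow> 'n::finite \<Rightarrow> real"
  assumes "\<And>i. ((\<lambda>x. f x i) has_derivative (\<lambda>h. f' h i)) (at a)"
  shows "((\<lambda>x. \<chi> i. f x i) has_derivative (\<lambda>h. \<chi> i. f' h i)) (at a)"
  using assms by (subst has_derivative_componentwise_within) (auto simp: Basis_vec_def inner_axis)

lemma attn_weight_twisted: "attn_weight \<beta> \<omega> p (twisted c \<omega> p) i j = exp \<beta>"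
  by (simp add: attn_weight_def twisted_def algebra_simps)

lemma attn_twisted: "attn \<beta> \<omega> p (twisted c \<omega> p :: real ^ 'n::finite) i j = 1 / CARD('n)"
  by (simp add: attn_def attn_weight_twisted)

text \<open>
  The derivative of each weight carries a factor \<open>sin 0\<close>, since the twist cancels the rotary phase
  exactly.
\<close>

lemma attn_has_derivative_zero_twisted:
  "((\<lambda>\<theta>. attn \<beta> \<omega> p \<theta> i j) has_derivative (\<lambda>h. 0)) (at (twisted c \<omega> p))"
proof -
  have W: "((\<lambda>\<theta>. attn_weight \<beta> \<omega> p \<theta> i j) has_derivative (\<lambda>h. 0)) (at (twisted c \<omega> p))" for j
    unfolding attn_weight_def
    by (rule derivative_eq_intros bounded_linear_imp_has_derivative bounded_linear_vec_nth refl
        | simp add: twisted_def algebra_simps)+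
  have "((\<lambda>\<theta>. attn \<beta> \<omega> p \<theta> i j) has_derivative (\<lambda>h. - attn_weight \<beta> \<omega> p (twisted c \<omega> p) i j
      * (inverse (\<Sum>k\<in>UNIV. attn_weight \<beta> \<omega> p (twisted c \<omega> p) i k) * (\<Sum>k\<in>(UNIV::'a set). 0)
         * inverse (\<Sum>k\<in>UNIV. attn_weight \<beta> \<omega> p (twisted c \<omega> p) i k))
      + 0 / (\<Sum>k\<in>UNIV. attn_weight \<beta> \<omega> p (twisted c \<omega> p) i k))) (at (twisted c \<omega> p))"
    unfolding attn_def
    by (intro has_derivative_divide has_derivative_sum W) (simp add: attn_weight_twisted)
  then show ?thesis by simp
qed

lemma phase_field_twisted_nth:
  "phase_field \<beta> \<omega> p (twisted c \<omega> p :: real ^ 'n::finite) $ i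
     = (\<Sum>j\<in>UNIV. sin (\<omega> * (p i - p j))) / CARD('n)"
  unfolding phase_field_def by (simp add: attn_twisted sum_divide_distrib) (simp add: twisted_def algebra_simps)

text \<open>
  Only the sine factor contributes, because the attention in front of it is stationary.
\<close>

lemma phase_field_has_derivative_twisted:
  "(phase_field \<beta> \<omega> p has_derivative
     (\<lambda>h. \<chi> i. \<Sum>j\<in>UNIV. cos (\<omega> * (p i - p j)) * (h $ j - h $ i) / CARD('n)))
     (at (twisted c \<omega> p :: real ^ 'n::finite))"
  unfolding phase_field_def
proof (intro has_derivative_vec_lambda has_derivative_sum)
  fix i j :: 'n
  let ?t = "twisted c \<omega> p :: real ^ 'n"
  have "((\<lambda>\<theta>. sin (\<theta> $ j - \<theta> $ i)) has_derivative
      (\<lambda>h. cos (\<omega> * (p i - p j)) * (h $ j - h $ i))) (at ?t)"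
    by (rule derivative_eq_intros bounded_linear_imp_has_derivative bounded_linear_vec_nth refl
        | simp add: twisted_def algebra_simps)+
  from has_derivative_mult[OF attn_has_derivative_zero_twisted[where \<beta> = \<beta> and i = i and j = j] this]
  show "((\<lambda>\<theta>. attn \<beta> \<omega> p \<theta> i j * sin (\<theta> $ j - \<theta> $ i)) has_derivative
      (\<lambda>h. cos (\<omega> * (p i - p j)) * (h $ j - h $ i) / CARD('n))) (at ?t)"
    by (simp add: attn_twisted)
qed

section \<open>The discrete Fourier transform diagonalizes the cosine kernel\<close>

definition unity_root :: "nat \<Rightarrow> int \<Rightarrow> complex" where
  "unity_root n a = cis (2 * pi * of_int a / real n)"

lemma unity_root_0 [simp]: "unity_root n 0 = 1"
  by (simp add: unity_root_def)

lemma unity_root_add: "unity_root n (a + b) = unity_root n a * unity_root n b"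
  by (simp add: unity_root_def cis_mult add_divide_distrib distrib_left)

lemma unity_root_mult_nat: "unity_root n (a * int k) = unity_root n a ^ k"
  unfolding unity_root_def Complex.DeMoivre by (rule arg_cong[of _ _ cis]) simp

lemma unity_root_eq_1_iff:
  assumes "n > 0"
  shows "unity_root n a = 1 \<longleftrightarrow> int n dvd a"
proof -
  have "unity_root n a = 1 \<longleftrightarrow> (\<exists>k::int. 2 * pi * of_int a / real n = of_int k * (2 * pi))"
    unfolding unity_root_def by (rule cis_eq_1_iff)
  also have "\<dots> \<longleftrightarrow> (\<exists>k::int. (of_int a :: real) = of_int (int n * k))"
    using assms by (simp add: field_simps)
  also have "\<dots> \<longleftrightarrow> int n dvd a"
    unfolding of_int_eq_iff dvd_def ..
  finally show ?thesis .
qed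

text \<open>
  Orthogonality of characters: a geometric sum whose ratio is an \<open>n\<close>-th root of unity.
\<close>

lemma sum_unity_root:
  fixes tok :: "'n::finite \<Rightarrow> nat"
  assumes "n > 0" and tok: "bij_betw tok UNIV {0..<n}"
  shows "(\<Sum>j\<in>UNIV. unity_root n (a * int (tok j))) = (if int n dvd a then of_nat n else 0)"
proof -
  let ?r = "unity_root n a"
  have "(\<Sum>j\<in>UNIV. unity_root n (a * int (tok j))) = (\<Sum>k\<in>{0..<n}. ?r ^ k)"
    using sum.reindex_bij_betw[OF tok, of "\<lambda>k. ?r ^ k"] by (simp add: unity_root_mult_nat)
  also have "\<dots> = (if int n dvd a then of_nat n else 0)"
  proof (cases "int n dvd a")
    case True
    then have "?r = 1" using assms by (simp add: unity_root_eq_1_iff)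
    then show ?thesis using True by simp
  next
    case False
    then have "?r \<noteq> 1" using assms by (simp add: unity_root_eq_1_iff)
    moreover have "?r ^ n = 1"
      using assms by (simp add: unity_root_mult_nat[symmetric] unity_root_eq_1_iff)
    ultimately show ?thesis using False by (simp add: atLeast0LessThan geometric_sum)
  qed
  finally show ?thesis .
qed

lemma sum_cis_character:
  fixes tok :: "'n::finite \<Rightarrow> nat"
  assumes "n > 0" and "bij_betw tok UNIV {0..<n}" and "\<not> int n dvd m"
  shows "(\<Sum>j\<in>UNIV. cis (2 * pi * of_int m * (x - real (tok j)) / real n)) = 0"
proof -
  have "(\<Sum>j\<in>UNIV. cis (2 * pi * of_int m * (x - real (tok j)) / real n))
     = (\<Sum>j\<in>UNIV. cis (2 * pi * of_int m * x / real n) * unity_root n (- m * int (tok j)))"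
    by (simp add: unity_root_def cis_mult diff_divide_distrib right_diff_distrib mult.assoc)
  also have "\<dots> = cis (2 * pi * of_int m * x / real n) * 0"
    using sum_unity_root[OF assms(1,2), of "- m"] assms(3)
    by (simp add: sum_distrib_left[symmetric])
  finally show ?thesis by simp
qed

text \<open>
  Rows and columns are both indexed by tokens; the token in column \<open>k\<close> stands for the
  frequency \<open>tok k\<close>.
\<close>

definition dft :: "('n::finite \<Rightarrow> nat) \<Rightarrow> complex ^ 'n ^ 'n" where
  "dft tok = (\<chi> j k. unity_root CARD('n) (int (tok j) * int (tok k)))"

definition inverse_dft :: "('n::finite \<Rightarrow> nat) \<Rightarrow> complex ^ 'n ^ 'n" where
  "inverse_dft tok = (\<chi> j k. unity_root CARD('n) (- (int (tok j) * int (tok k))) / CARD('n))"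

lemma int_dvd_diff_iff_eq:
  assumes "bij_betw tok UNIV {0..<n}"
  shows "int n dvd int (tok i) - int (tok j) \<longleftrightarrow> i = j"
proof
  assume "int n dvd int (tok i) - int (tok j)"
  then have "int (tok i) mod int n = int (tok j) mod int n"
    by (simp add: mod_eq_dvd_iff)
  moreover have "tok i < n" "tok j < n"
    using assms by (auto simp: bij_betw_def)
  ultimately have "tok i = tok j" by simp
  with assms show "i = j" by (auto simp: bij_betw_def inj_on_def)
qed simp

lemma invertible_dft:
  fixes tok :: "'n::finite \<Rightarrow> nat"
  assumes tok: "bij_betw tok UNIV {0..<CARD('n)}"
  shows "invertible (dft tok)"
proof -
  have "(dft tok ** inverse_dft tok) $ i $ j = mat 1 $ i $ j" for i j
  proof -
    have "(dft tok ** inverse_dft tok) $ i $ j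
        = (\<Sum>k\<in>UNIV. unity_root CARD('n) ((int (tok i) - int (tok j)) * int (tok k))) / CARD('n)"
      by (simp add: matrix_matrix_mult_def dft_def inverse_dft_def unity_root_add[symmetric]
          sum_divide_distrib algebra_simps)
    then show ?thesis
      by (simp add: sum_unity_root[OF _ tok] int_dvd_diff_iff_eq[OF tok] mat_def)
  qed
  then have "dft tok ** inverse_dft tok = mat 1" by (simp add: vec_eq_iff)
  then show ?thesis
    using matrix_left_right_inverse unfolding invertible_def by blast
qed

text \<open>
  The Fourier coefficient of \<open>cos (2 * pi * m * x / n)\<close> at the frequency \<open>tok k\<close>.
\<close>

definition twist_eigenvalue :: "('n::finite \<Rightarrow> nat) \<Rightarrow> int \<Rightarrow> 'n \<Rightarrow> complex" where
  "twist_eigenvalue tok m k =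
     (of_bool (int CARD('n) dvd int (tok k) - m) + of_bool (int CARD('n) dvd int (tok k) + m)) / 2"

text \<open>
  Writing the cosine as the mean of the characters of frequency \<open>m\<close> and \<open>-m\<close>, convolution
  with either one annihilates every Fourier mode except the one of the same frequency modulo
  \<open>n\<close>, which it multiplies by \<open>n\<close>.
\<close>

lemma cosine_kernel_diagonalized_by_dft:
  fixes tok :: "'n::finite \<Rightarrow> nat"
  assumes tok: "bij_betw tok UNIV {0..<CARD('n)}"
    and J: "J = (1 / real CARD('n)) *\<^sub>R
      (\<chi> i j. cos (2 * pi * of_int m * (real (tok i) - real (tok j)) / real CARD('n)))"
  shows "complexify J ** dft tok = dft tok ** diag_mat (twist_eigenvalue tok m)"
proof -
  let ?n = "CARD('n)"
  let ?e = "unity_root ?n"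
  \<comment> \<open>Frequencies congruent modulo \<open>n\<close> give the same character.\<close>
  have aliasing: "of_bool (int ?n dvd k - a) * ?e (a * t) = of_bool (int ?n dvd k - a) * ?e (t * k)"
    for a k t :: int
  proof (cases "int ?n dvd k - a")
    case True
    have "?e (t * k) = ?e (a * t) * ?e (t * (k - a))"
      by (simp add: unity_root_add[symmetric] algebra_simps)
    moreover have "?e (t * (k - a)) = 1" using True by (simp add: unity_root_eq_1_iff)
    ultimately show ?thesis by simp
  qed simp
  have entry: "complexify J $ i $ j
      = (?e (m * (int (tok i) - int (tok j))) + ?e (- m * (int (tok i) - int (tok j)))) / (2 * ?n)"
    for i j
    by (simp add: complexify_def J unity_root_def complex_eq_iff mult_ac)
  have conv: "(\<Sum>j\<in>UNIV. ?e (a * (t - int (tok j))) * ?e (int (tok j) * k))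
      = ?n * (of_bool (int ?n dvd k - a) * ?e (t * k))" for a t k
  proof -
    have "(\<Sum>j\<in>UNIV. ?e (a * (t - int (tok j))) * ?e (int (tok j) * k))
        = (\<Sum>j\<in>UNIV. ?e (a * t) * ?e ((k - a) * int (tok j)))"
      by (simp add: unity_root_add[symmetric] algebra_simps)
    also have "\<dots> = ?n * (of_bool (int ?n dvd k - a) * ?e (a * t))"
      by (simp add: sum_distrib_left[symmetric] sum_unity_root[OF _ tok])
    finally show ?thesis unfolding aliasing[of k a t] .
  qed
  have "(complexify J ** dft tok) $ i $ k = (dft tok ** diag_mat (twist_eigenvalue tok m)) $ i $ k"
    for i k
  proof -
    have "(complexify J ** dft tok) $ i $ k
        = ((\<Sum>j\<in>UNIV. ?e (m * (int (tok i) - int (tok j))) * ?e (int (tok j) * int (tok k)))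
          + (\<Sum>j\<in>UNIV. ?e (- m * (int (tok i) - int (tok j))) * ?e (int (tok j) * int (tok k))))
          / (2 * ?n)"
      unfolding matrix_matrix_mult_def
      by (simp add: entry dft_def sum.distrib[symmetric] sum_divide_distrib distrib_right
          del: mult_minus_left)
    then show ?thesis
      unfolding conv
      by (simp add: matrix_mult_diag_mat_nth dft_def twist_eigenvalue_def add_divide_distrib distrib_left
          mult.commute)
  qed
  then show ?thesis by (simp add: vec_eq_iff)
qed

text \<open>
  The positions form a complete residue system, so \<open>a\<close> and \<open>b\<close> can be taken as the tokens
  at the residues of \<open>m\<close> and \<open>-m\<close>. The token \<open>z\<close> at position \<open>0\<close> differs from both; it
  is a mode with eigenvalue \<open>0\<close>.
\<close>

lemma twist_eigenvalue_supported_on_pair: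
  fixes tok :: "'n::finite \<Rightarrow> nat"
  assumes tok: "bij_betw tok UNIV {0..<CARD('n)}" and m: "\<not> int CARD('n) dvd m"
  obtains a b z where "\<And>k. twist_eigenvalue tok m k = (of_bool (k = a) + of_bool (k = b)) / 2"
    and "a = b \<longleftrightarrow> int CARD('n) dvd 2 * m" and "z \<noteq> a" and "z \<noteq> b"
proof -
  let ?n = "int CARD('n)"
  have residue: "\<exists>k. ?n dvd int (tok k) - x" for x
  proof -
    have "nat (x mod ?n) \<in> range tok"
      using tok by (auto simp: bij_betw_def nat_less_iff)
    then obtain k where "int (tok k) = x mod ?n"
      by (metis int_nat_eq imageE of_nat_0_less_iff pos_mod_sign zero_less_card_finite)
    then show ?thesis by (metis mod_eq_dvd_iff mod_mod_trivial)
  qed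
  obtain a b z where a: "?n dvd int (tok a) - m" and b: "?n dvd int (tok b) - (- m)"
    and z: "?n dvd int (tok z) - 0"
    using residue by metis
  have at: "?n dvd int (tok k) - x \<longleftrightarrow> k = l" if "?n dvd int (tok l) - x" for k l x
    using that int_dvd_diff_iff_eq[OF tok, of k l]
    by (metis dvd_diff_right_iff[of ?n "int (tok l) - x" "int (tok k) - x"]
        diff_diff_eq2 diff_add_cancel dvd_diff dvd_add)
  show ?thesis
  proof
    show "twist_eigenvalue tok m k = (of_bool (k = a) + of_bool (k = b)) / 2" for k
      using at[OF a, of k] at[OF b, of k] by (simp add: twist_eigenvalue_def)
    have "a = b \<longleftrightarrow> ?n dvd int (tok b) - m" using at[OF a, of b] by auto
    also have "\<dots> \<longleftrightarrow> ?n dvd 2 * m"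
      using dvd_add_right_iff[OF b, of "- (2 * m)"] by simp
    finally show "a = b \<longleftrightarrow> ?n dvd 2 * m" .
    show "z \<noteq> a" "z \<noteq> b"
      using dvd_diff[OF z a] dvd_diff[OF b z] m by auto
  qed
qed

section \<open>Linear stability of the twisted equilibria\<close>

text \<open>
  At any twisted configuration the Jacobian is the negative of a graph Laplacian with the signed
  weights \<open>cos (\<omega> * (p i - p j)) / n\<close>. When the rows of weights sum to zero, its diagonal
  correction disappears and only the matrix of weights is left.
\<close>

lemma phase_field_linearization_balanced:
  fixes p :: "'n::finite \<Rightarrow> real"
  assumes cos: "\<And>i. (\<Sum>j\<in>UNIV. cos (\<omega> * (p i - p j))) = 0"
  shows "(phase_field \<beta> \<omega> p has_derivative
      (*v) ((1 / real CARD('n)) *\<^sub>R (\<chi> i j. cos (\<omega> * (p i - p j))))) (at (twisted c \<omega> p))"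
proof -
  have "(\<Sum>j\<in>UNIV. cos (\<omega> * (p i - p j)) * (h $ j - h $ i) / CARD('n))
      = (((1 / real CARD('n)) *\<^sub>R (\<chi> i j. cos (\<omega> * (p i - p j)))) *v h) $ i"
    for h :: "real ^ 'n" and i
  proof -
    have "(\<Sum>j\<in>UNIV. cos (\<omega> * (p i - p j)) * (h $ j - h $ i) / CARD('n))
       = (\<Sum>j\<in>UNIV. cos (\<omega> * (p i - p j)) * h $ j / CARD('n))
         - (\<Sum>j\<in>UNIV. cos (\<omega> * (p i - p j))) * h $ i / CARD('n)"
      by (simp add: sum_subtractf sum_distrib_right sum_divide_distrib right_diff_distrib
          diff_divide_distrib)
    then show ?thesis by (simp add: cos matrix_vector_mult_def)
  qed
  then have "(\<lambda>h. \<chi> i. \<Sum>j\<in>UNIV. cos (\<omega> * (p i - p j)) * (h $ j - h $ i) / CARD('n))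
      = (*v) ((1 / real CARD('n)) *\<^sub>R (\<chi> i j. cos (\<omega> * (p i - p j))))"
    by (simp add: fun_eq_iff vec_eq_iff)
  with phase_field_has_derivative_twisted[of \<beta> \<omega> p c] show ?thesis by simp
qed

lemma jacobian_eqI:
  fixes F :: "real ^ 'n \<Rightarrow> real ^ 'm"
  assumes "(F has_derivative (*v) A) (at x)"
  shows "jacobian F (at x) = A"
  by (simp add: jacobian_def frechet_derivative_at[OF assms, symmetric])

theorem proposition7p1:
  fixes tok :: "'n::finite \<Rightarrow> nat" and n :: nat and m mbar :: int
    and \<beta> \<omega> c :: real and p :: "'n \<Rightarrow> real"
    and F :: "real ^ 'n \<Rightarrow> real ^ 'n" and \<theta> :: "real ^ 'n" and J C :: "real ^ 'n ^ 'n"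
  assumes n: "n = CARD('n)" "n \<ge> 2"
    and tok: "bij_betw tok UNIV {0..<n}"
    and p: "p = (\<lambda>j. real (tok j))"
    and beta: "\<beta> \<ge> 0"
    and omega: "\<omega> = 2 * pi * of_int m / real n"
    and mbar: "mbar = m mod int n" "mbar \<noteq> 0"
    and F: "F = phase_field \<beta> \<omega> p"
    and theta: "\<theta> = twisted c \<omega> p"
    and J: "J = jacobian F (at \<theta>)"
    and C: "C = (\<chi> i j. cos (2 * pi * of_int m * (real (tok i) - real (tok j)) / real n))"
  shows "equilibrium F \<theta> \<and> F differentiable (at \<theta>) \<and>
    J = (1 / real n) *\<^sub>R C \<and>
    (\<not> [2 * mbar = 0] (mod int n) \<longrightarrow>
      has_eigenvalue_with_multiplicity (complexify J) (1/2) 2 \<and>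
      has_eigenvalue_with_multiplicity (complexify J) 0 (n - 2)) \<and>
    (even n \<and> mbar = int n div 2 \<longrightarrow>
      has_eigenvalue_with_multiplicity (complexify J) 1 1 \<and>
      has_eigenvalue_with_multiplicity (complexify J) 0 (n - 1)) \<and>
    has_growing_mode F \<theta> \<and> has_center_mode F \<theta> \<and> \<not> has_stable_mode F \<theta> \<and>
    \<not> hyperbolic F \<theta> \<and> linearly_unstable F \<theta> \<and> \<not> hyperbolic_saddle F \<theta>"
proof -
  have m: "\<not> int n dvd m" using mbar by auto
  have tokN: "bij_betw tok UNIV {0..<CARD('n)}" using tok n by simp
  have angle: "\<omega> * (p i - p j) = 2 * pi * of_int m * (real (tok i) - real (tok j)) / real n" for i j
    by (simp add: omega p)
  have sum_cis: "(\<Sum>j\<in>UNIV. cis (\<omega> * (p i - p j))) = 0" for i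
    unfolding angle using n m tok by (intro sum_cis_character) auto
  have sum_cos: "(\<Sum>j\<in>UNIV. cos (\<omega> * (p i - p j))) = 0" for i
    using arg_cong[OF sum_cis[of i], of Re] by simp
  have sum_sin: "(\<Sum>j\<in>UNIV. sin (\<omega> * (p i - p j))) = 0" for i
    using arg_cong[OF sum_cis[of i], of Im] by simp

  have equil: "equilibrium F \<theta>"
    by (simp add: equilibrium_def F theta vec_eq_iff phase_field_twisted_nth sum_sin)
  have deriv: "(F has_derivative (*v) ((1 / real n) *\<^sub>R C)) (at \<theta>)"
    using phase_field_linearization_balanced[OF sum_cos, of \<beta> c]
    unfolding F theta C n(1)[symmetric] angle .
  have diff: "F differentiable (at \<theta>)" using deriv by (auto simp: differentiable_def)
  have JC: "J = (1 / real n) *\<^sub>R C" unfolding J by (rule jacobian_eqI[OF deriv])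

  define d where "d = twist_eigenvalue tok m"
  have diagonalized: "complexify J ** dft tok = dft tok ** diag_mat d" "invertible (dft tok)"
    unfolding d_def using invertible_dft[OF tokN] cosine_kernel_diagonalized_by_dft[OF tokN]
    by (simp_all add: JC C n(1))
  obtain a b z where d: "\<And>k. d k = (of_bool (k = a) + of_bool (k = b)) / 2"
    and ab: "a = b \<longleftrightarrow> int n dvd 2 * m" and z: "z \<noteq> a" "z \<noteq> b"
    using twist_eigenvalue_supported_on_pair[OF tokN] m unfolding d_def n(1) by metis
  have mult: "has_eigenvalue_with_multiplicity (complexify J) (d k) (card {l. d l = d k})" for k
    by (rule multiplicity_of_diagonalized[OF diagonalized]) simp
  have mode: "linear_mode F \<theta> \<mu> \<longleftrightarrow> \<mu> \<in> range d" for \<mu>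
    unfolding linear_mode_def J[symmetric] by (rule eigenvalue_of_diagonalized[OF diagonalized])

  have zero: "has_eigenvalue_with_multiplicity (complexify J) 0 (n - card {a, b})"
  proof -
    have "{l. d l = d z} = UNIV - {a, b}" using z by (auto simp: d)
    then show ?thesis using mult[of z] z by (simp add: d n(1) card_Diff_subset)
  qed
  have congr: "[2 * mbar = 0] (mod int n) \<longleftrightarrow> a = b"
    unfolding ab mbar by (simp add: cong_def mod_mult_right_eq dvd_eq_mod_eq_0)
  have generic: "has_eigenvalue_with_multiplicity (complexify J) (1/2) 2 \<and>
      has_eigenvalue_with_multiplicity (complexify J) 0 (n - 2)" if "a \<noteq> b"
  proof -
    have "{l. d l = d a} = {a, b}" using that by (auto simp: d)
    then show ?thesis using mult[of a] zero that by (simp add: d flip: numeral_2_eq_2)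
  qed
  have antipodal: "has_eigenvalue_with_multiplicity (complexify J) 1 1 \<and>
      has_eigenvalue_with_multiplicity (complexify J) 0 (n - 1)" if "a = b"
  proof -
    have "{l. d l = d a} = {a}" using that by (auto simp: d)
    then show ?thesis using mult[of a] zero that by (simp add: d)
  qed
  have half_cong: "[2 * mbar = 0] (mod int n)" if "even n" "mbar = int n div 2"
    using that by (simp add: cong_0_iff)

  have nonneg: "Re (d k) \<ge> 0" for k by (simp add: d)
  have growing: "has_growing_mode F \<theta>"
    unfolding has_growing_mode_def mode by (intro exI[of _ "d a"] conjI rangeI) (simp add: d)
  have center: "has_center_mode F \<theta>"
    unfolding has_center_mode_def mode by (intro exI[of _ "d z"] conjI rangeI) (simp add: d z)
  have no_stable: "\<not> has_stable_mode F \<theta>"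
    unfolding has_stable_mode_def mode using nonneg by (auto simp: not_less)
  have unstable: "linearly_unstable F \<theta>"
    using growing by (simp add: has_growing_mode_def linearly_unstable_def)
  have nonhyperbolic: "\<not> hyperbolic F \<theta>" "\<not> hyperbolic_saddle F \<theta>"
    using center by (auto simp: has_center_mode_def hyperbolic_def hyperbolic_saddle_def)
  show ?thesis
    using equil diff JC generic antipodal half_cong congr growing center no_stable
      unstable nonhyperbolic by blast
qed

end
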